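(* Let $L$ be a complete lattice that is finitely bi-spatial, that is, every element of $L$ is a join of join-irreducible elements of $L$ and every element of $L$ is a meet of meet-irreducible elements of $L$. Then $L$ is isomorphic to a direct product $\prod_{i\in I}L_i$ of directly indecomposable lattices $L_i$.
   Context: In a bounded lattice $L$, an element $p$ is join-irreducible if $p\neq 0$ and $p=x\vee y$ implies $p\in\{x,y\}$, for all $x,y\in L$. Meet-irreducible elements are defined dually (so $u\neq 1$ and $u=x\wedge y$ implies $u\in\{x,y\}$). Joins and meets are of arbitrary (possibly infinite, possibly empty) sets; the empty join is $0$ and the empty meet is $1$. The index set $I$ may be arbitrary (infinite or empty). A lattice is directly indecomposable if it is not isomorphic to a product of two lattices each having more than one element. *)

theory Defs
  imports "HOL-Algebra.Complete_Lattice"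
begin

definition join_irreducible :: "('a, 'm) gorder_scheme \<Rightarrow> 'a \<Rightarrow> bool" where
  "join_irreducible L p \<longleftrightarrow> p \<in> carrier L \<and> p \<noteq> \<bottom>\<^bsub>L\<^esub> \<and>
     (\<forall>x\<in>carrier L. \<forall>y\<in>carrier L. p = x \<squnion>\<^bsub>L\<^esub> y \<longrightarrow> p = x \<or> p = y)"

definition meet_irreducible :: "('a, 'm) gorder_scheme \<Rightarrow> 'a \<Rightarrow> bool" where
  "meet_irreducible L u \<longleftrightarrow> u \<in> carrier L \<and> u \<noteq> \<top>\<^bsub>L\<^esub> \<and>
     (\<forall>x\<in>carrier L. \<forall>y\<in>carrier L. u = x \<sqinter>\<^bsub>L\<^esub> y \<longrightarrow> u = x \<or> u = y)"

definition finitely_bispatial :: "('a, 'm) gorder_scheme \<Rightarrow> bool" where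
  "finitely_bispatial L \<longleftrightarrow>
     (\<forall>x\<in>carrier L. \<exists>P. (\<forall>p\<in>P. join_irreducible L p) \<and> x = \<Squnion>\<^bsub>L\<^esub> P) \<and>
     (\<forall>x\<in>carrier L. \<exists>U. (\<forall>u\<in>U. meet_irreducible L u) \<and> x = \<Sqinter>\<^bsub>L\<^esub> U)"

text \<open>The predicates \<open>join_pres\<close> and \<open>meet_pres\<close> of the library include the requirement
  that both structures are lattices.\<close>

definition lattice_isomorphic :: "('a, 'm) gorder_scheme \<Rightarrow> ('b, 'n) gorder_scheme \<Rightarrow> bool" where
  "lattice_isomorphic X Y \<longleftrightarrow>
     (\<exists>f. bij_betw f (carrier X) (carrier Y) \<and> join_pres X Y f \<and> meet_pres X Y f)"

definition product_lattice :: "'i set \<Rightarrow> ('i \<Rightarrow> ('a, 'm) gorder_scheme) \<Rightarrow> ('i \<Rightarrow> 'a) gorder" where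
  "product_lattice I F =
     \<lparr>carrier = (\<Pi>\<^sub>E i\<in>I. carrier (F i)), eq = (=), le = (\<lambda>x y. \<forall>i\<in>I. x i \<sqsubseteq>\<^bsub>F i\<^esub> y i)\<rparr>"

definition binary_product_lattice ::
    "('a, 'm) gorder_scheme \<Rightarrow> ('b, 'n) gorder_scheme \<Rightarrow> ('a \<times> 'b) gorder" where
  "binary_product_lattice A B =
     \<lparr>carrier = carrier A \<times> carrier B, eq = (=),
      le = (\<lambda>x y. fst x \<sqsubseteq>\<^bsub>A\<^esub> fst y \<and> snd x \<sqsubseteq>\<^bsub>B\<^esub> snd y)\<rparr>"

text \<open>A definition cannot quantify over types, so the two factors below live on the type of
  \<open>L\<close> itself.  Nothing is lost: if \<open>L\<close> is isomorphic to a product of two lattices on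
  arbitrary types, each factor embeds into \<open>L\<close>.  See lemma
  \<open>directly_indecomposable_any_type\<close>.\<close>

definition directly_indecomposable :: "'a gorder \<Rightarrow> bool" where
  "directly_indecomposable L \<longleftrightarrow> lattice L \<and>
     \<not> (\<exists>(A :: 'a gorder) (B :: 'a gorder). lattice A \<and> lattice B \<and>
          (\<exists>a\<in>carrier A. \<exists>a'\<in>carrier A. a \<noteq> a') \<and>
          (\<exists>b\<in>carrier B. \<exists>b'\<in>carrier B. b \<noteq> b') \<and>
          lattice_isomorphic L (binary_product_lattice A B))"


lemma least_order_iso:
  assumes f: "bij_betw f (carrier X) (carrier Y)"
    and le: "\<And>x y. x \<in> carrier X \<Longrightarrow> y \<in> carrier X \<Longrightarrow> f x \<sqsubseteq>\<^bsub>Y\<^esub> f y \<longleftrightarrow> x \<sqsubseteq>\<^bsub>X\<^esub> y"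
    and S: "S \<subseteq> carrier X" and s: "least X s (Upper X S)"
  shows "least Y (f s) (Upper Y (f ` S))"
proof -
  have fY: "carrier Y = f ` carrier X" using f by (simp add: bij_betw_def)
  have "f u \<in> Upper Y (f ` S) \<longleftrightarrow> u \<in> Upper X S" if "u \<in> carrier X" for u
  proof -
    have "f u \<in> Upper Y (f ` S) \<longleftrightarrow> (\<forall>x\<in>S. f x \<sqsubseteq>\<^bsub>Y\<^esub> f u)"
      using S that unfolding Upper_def fY by blast
    also have "\<dots> \<longleftrightarrow> (\<forall>x\<in>S. x \<sqsubseteq>\<^bsub>X\<^esub> u)" using S le that by (meson subsetD)
    also have "\<dots> \<longleftrightarrow> u \<in> Upper X S" using S that unfolding Upper_def by blast
    finally show ?thesis .
  qed
  then have *: "u \<in> carrier X \<Longrightarrow> f u \<in> Upper Y (f ` S) \<Longrightarrow> u \<in> Upper X S"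
    and m: "u \<in> carrier X \<Longrightarrow> u \<in> Upper X S \<Longrightarrow> f u \<in> Upper Y (f ` S)" for u by blast+
  have s': "s \<in> carrier X" "s \<in> Upper X S" and min: "\<And>u. u \<in> Upper X S \<Longrightarrow> s \<sqsubseteq>\<^bsub>X\<^esub> u"
    using s by (auto simp: least_def Upper_def)
  show ?thesis
    unfolding least_def
  proof (intro conjI ballI)
    show "Upper Y (f ` S) \<subseteq> carrier Y" by (rule Upper_closed)
    show "f s \<in> Upper Y (f ` S)" using m s' by blast
    fix v assume v: "v \<in> Upper Y (f ` S)"
    then have "v \<in> f ` carrier X" unfolding Upper_def fY by (rule IntD2)
    then obtain u where u: "u \<in> carrier X" "v = f u" by blast
    with v * min have "s \<sqsubseteq>\<^bsub>X\<^esub> u" by simp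
    with u le s' show "f s \<sqsubseteq>\<^bsub>Y\<^esub> v" by simp
  qed
qed

lemma greatest_order_iso:
  assumes f: "bij_betw f (carrier X) (carrier Y)"
    and le: "\<And>x y. x \<in> carrier X \<Longrightarrow> y \<in> carrier X \<Longrightarrow> f x \<sqsubseteq>\<^bsub>Y\<^esub> f y \<longleftrightarrow> x \<sqsubseteq>\<^bsub>X\<^esub> y"
    and S: "S \<subseteq> carrier X" and s: "greatest X s (Lower X S)"
  shows "greatest Y (f s) (Lower Y (f ` S))"
  using least_order_iso[of f "inv_gorder X" "inv_gorder Y" S s] f le S s by simp

lemma (in partial_order) join_eqI:
  assumes "least L s (Upper L {x, y})" shows "x \<squnion> y = s"
  unfolding join_def sup_def
  by (metis (mono_tags, lifting) assms someI weak_least_unique eq_is_equal)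

lemma (in partial_order) meet_eqI:
  assumes "greatest L s (Lower L {x, y})" shows "x \<sqinter> y = s"
  unfolding meet_def inf_def
  by (metis (mono_tags, lifting) assms someI weak_greatest_unique eq_is_equal)

lemma (in lattice) join_least: 
  "x \<in> carrier L \<Longrightarrow> y \<in> carrier L \<Longrightarrow> least L (x \<squnion> y) (Upper L {x, y})"
  by (metis sup_of_two_exists join_eqI)

lemma (in lattice) meet_greatest:
  "x \<in> carrier L \<Longrightarrow> y \<in> carrier L \<Longrightarrow> greatest L (x \<sqinter> y) (Lower L {x, y})"
  by (metis inf_of_two_exists meet_eqI)

lemma order_iso_lattice:
  assumes X: "lattice X" and Y: "partial_order Y"
    and f: "bij_betw f (carrier X) (carrier Y)"
    and le: "\<And>x y. x \<in> carrier X \<Longrightarrow> y \<in> carrier X \<Longrightarrow> f x \<sqsubseteq>\<^bsub>Y\<^esub> f y \<longleftrightarrow> x \<sqsubseteq>\<^bsub>X\<^esub> y"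
  shows "lattice Y" "join_pres X Y f" "meet_pres X Y f"
proof -
  interpret X: lattice X by fact
  interpret Y: partial_order Y by fact
  have fY: "carrier Y = f ` carrier X" using f by (simp add: bij_betw_def)
  have lub: "least Y (f (x \<squnion>\<^bsub>X\<^esub> y)) (Upper Y {f x, f y})"
    if "x \<in> carrier X" "y \<in> carrier X" for x y
    using least_order_iso[OF f le _ X.join_least[OF that]] that by simp
  have glb: "greatest Y (f (x \<sqinter>\<^bsub>X\<^esub> y)) (Lower Y {f x, f y})"
    if "x \<in> carrier X" "y \<in> carrier X" for x y
    using greatest_order_iso[OF f le _ X.meet_greatest[OF that]] that by simp
  show "lattice Y"
    by unfold_locales (use lub glb in \<open>unfold fY, blast+\<close>)
  with X show "join_pres X Y f" "meet_pres X Y f"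
    using Y.join_eqI[OF lub] Y.meet_eqI[OF glb] unfolding join_pres_def meet_pres_def by auto
qed

lemma lattice_isomorphic_iff_order_iso:
  "lattice_isomorphic X Y \<longleftrightarrow> lattice X \<and> partial_order Y \<and>
     (\<exists>f. bij_betw f (carrier X) (carrier Y) \<and>
          (\<forall>x\<in>carrier X. \<forall>y\<in>carrier X. f x \<sqsubseteq>\<^bsub>Y\<^esub> f y \<longleftrightarrow> x \<sqsubseteq>\<^bsub>X\<^esub> y))"
    (is "?L \<longleftrightarrow> ?R")
proof
  assume ?L
  then obtain f where f: "bij_betw f (carrier X) (carrier Y)"
    and j: "join_pres X Y f" unfolding lattice_isomorphic_def by blast
  interpret X: lattice X using j by (simp add: join_pres_def)
  interpret Y: lattice Y using j by (simp add: join_pres_def)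
  have "f x \<sqsubseteq>\<^bsub>Y\<^esub> f y \<longleftrightarrow> x \<sqsubseteq>\<^bsub>X\<^esub> y" if xy: "x \<in> carrier X" "y \<in> carrier X" for x y
  proof -
    have *: "f x \<in> carrier Y" "f y \<in> carrier Y" using f xy by (auto simp: bij_betw_def)
    have "f x \<squnion>\<^bsub>Y\<^esub> f y = f (x \<squnion>\<^bsub>X\<^esub> y)" using j xy by (simp add: join_pres_def)
    moreover have "f (x \<squnion>\<^bsub>X\<^esub> y) = f y \<longleftrightarrow> x \<squnion>\<^bsub>X\<^esub> y = y"
      using f xy X.join_closed by (metis bij_betw_def inj_on_eq_iff)
    ultimately show ?thesis using X.le_iff_meet Y.le_iff_meet xy * by metis
  qed
  with f show ?R using X.lattice_axioms Y.partial_order_axioms by blast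
next
  assume ?R
  then show ?L unfolding lattice_isomorphic_def by (metis order_iso_lattice(2,3))
qed

lemma partial_order_binary_product:
  assumes "partial_order A" "partial_order B"
  shows "partial_order (binary_product_lattice A B)"
proof -
  interpret A: partial_order A by fact
  interpret B: partial_order B by fact
  show ?thesis
    by unfold_locales (auto simp: binary_product_lattice_def intro: A.le_trans B.le_trans)
qed

lemma partial_order_product:
  assumes "\<And>i. i \<in> I \<Longrightarrow> partial_order (F i)"
  shows "partial_order (product_lattice I F)"
proof unfold_locales
  fix x y assume "x \<sqsubseteq>\<^bsub>product_lattice I F\<^esub> y" "y \<sqsubseteq>\<^bsub>product_lattice I F\<^esub> x"
    "x \<in> carrier (product_lattice I F)" "y \<in> carrier (product_lattice I F)"
  then show "x .=\<^bsub>product_lattice I F\<^esub> y"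
    using partial_order.le_antisym[OF assms]
    by (auto simp: product_lattice_def PiE_iff intro!: extensionalityI[of x I y])
next
  fix x y z assume "x \<sqsubseteq>\<^bsub>product_lattice I F\<^esub> y" "y \<sqsubseteq>\<^bsub>product_lattice I F\<^esub> z"
    "x \<in> carrier (product_lattice I F)" "y \<in> carrier (product_lattice I F)"
    "z \<in> carrier (product_lattice I F)"
  then show "x \<sqsubseteq>\<^bsub>product_lattice I F\<^esub> z"
    using weak_partial_order.le_trans[OF partial_order.axioms(1)[OF assms]]
    by (simp add: product_lattice_def) (meson PiE_mem)
qed (use weak_partial_order.le_refl[OF partial_order.axioms(1)[OF assms]] in
      \<open>auto simp: product_lattice_def\<close>)

lemma least_product:
  assumes S: "S \<subseteq> carrier (product_lattice I F)" and s: "s \<in> carrier (product_lattice I F)"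
    and c: "\<And>i. i \<in> I \<Longrightarrow> least (F i) (s i) (Upper (F i) ((\<lambda>x. x i) ` S))"
  shows "least (product_lattice I F) s (Upper (product_lattice I F) S)"
proof -
  have "s i \<in> Upper (F i) ((\<lambda>x. x i) ` S)" if "i \<in> I" for i
    using c[OF that] by (simp add: least_def)
  moreover have m: "x i \<in> carrier (F i)" if "x \<in> S" "i \<in> I" for x i
    using S that by (auto simp: product_lattice_def)
  ultimately have bd: "x i \<sqsubseteq>\<^bsub>F i\<^esub> s i" if "x \<in> S" "i \<in> I" for x i
    using that unfolding Upper_def by blast
  have ex: "s i \<sqsubseteq>\<^bsub>F i\<^esub> u i"
    if u: "u \<in> Upper (product_lattice I F) S" and i: "i \<in> I" for u i
  proof -
    have "u \<in> carrier (product_lattice I F)" using u by (simp add: Upper_def)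
    moreover have "u i \<in> Upper (F i) ((\<lambda>x. x i) ` S)"
      using u i S m unfolding Upper_def by (auto simp: product_lattice_def)
    ultimately show ?thesis using c[OF i] by (simp add: least_def)
  qed
  have "s \<in> Upper (product_lattice I F) S"
    using s bd by (auto simp: Upper_def product_lattice_def)
  moreover have "Upper (product_lattice I F) S \<subseteq> carrier (product_lattice I F)"
    by (auto simp: Upper_def)
  ultimately show ?thesis
    using ex by (auto simp: least_def product_lattice_def)
qed

lemma greatest_product:
  assumes S: "S \<subseteq> carrier (product_lattice I F)" and s: "s \<in> carrier (product_lattice I F)"
    and c: "\<And>i. i \<in> I \<Longrightarrow> greatest (F i) (s i) (Lower (F i) ((\<lambda>x. x i) ` S))"
  shows "greatest (product_lattice I F) s (Lower (product_lattice I F) S)"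
proof -
  have "s i \<in> Lower (F i) ((\<lambda>x. x i) ` S)" if "i \<in> I" for i
    using c[OF that] by (simp add: greatest_def)
  moreover have m: "x i \<in> carrier (F i)" if "x \<in> S" "i \<in> I" for x i
    using S that by (auto simp: product_lattice_def)
  ultimately have bd: "s i \<sqsubseteq>\<^bsub>F i\<^esub> x i" if "x \<in> S" "i \<in> I" for x i
    using that unfolding Lower_def by blast
  have ex: "u i \<sqsubseteq>\<^bsub>F i\<^esub> s i"
    if u: "u \<in> Lower (product_lattice I F) S" and i: "i \<in> I" for u i
  proof -
    have "u \<in> carrier (product_lattice I F)" using u by (simp add: Lower_def)
    moreover have "u i \<in> Lower (F i) ((\<lambda>x. x i) ` S)"
      using u i S m unfolding Lower_def by (auto simp: product_lattice_def)
    ultimately show ?thesis using c[OF i] by (simp add: greatest_def)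
  qed
  have "s \<in> Lower (product_lattice I F) S"
    using s bd by (auto simp: Lower_def product_lattice_def)
  moreover have "Lower (product_lattice I F) S \<subseteq> carrier (product_lattice I F)"
    by (auto simp: Lower_def)
  ultimately show ?thesis
    using ex by (auto simp: greatest_def product_lattice_def)
qed

lemma lattice_product:
  assumes F: "\<And>i. i \<in> I \<Longrightarrow> lattice (F i)"
  shows "lattice (product_lattice I F)"
proof -
  have po: "partial_order (F i)" if "i \<in> I" for i
    using F[OF that] by (simp add: lattice_def upper_semilattice_def)
  interpret P: partial_order "product_lattice I F" by (rule partial_order_product[OF po])
  show ?thesis
  proof unfold_locales
    fix x y assume xy: "x \<in> carrier (product_lattice I F)" "y \<in> carrier (product_lattice I F)"
    let ?s = "\<lambda>i\<in>I. x i \<squnion>\<^bsub>F i\<^esub> y i" and ?t = "\<lambda>i\<in>I. x i \<sqinter>\<^bsub>F i\<^esub> y i"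
    have m: "x i \<in> carrier (F i)" "y i \<in> carrier (F i)" if "i \<in> I" for i
      using xy that by (auto simp: product_lattice_def)
    have l: "least (F i) (?s i) (Upper (F i) {x i, y i})"
      "greatest (F i) (?t i) (Lower (F i) {x i, y i})" if "i \<in> I" for i
      using lattice.join_least[OF F m, of i] lattice.meet_greatest[OF F m, of i] that by auto
    have c: "?s \<in> carrier (product_lattice I F)" "?t \<in> carrier (product_lattice I F)"
      using l by (auto simp: product_lattice_def least_def greatest_def Upper_def Lower_def)
    show "\<exists>s. least (product_lattice I F) s (Upper (product_lattice I F) {x, y})"
      using least_product[where S = "{x, y}" and F = F and I = I and s = ?s] xy c l by auto
    show "\<exists>s. greatest (product_lattice I F) s (Lower (product_lattice I F) {x, y})"
      using greatest_product[where S = "{x, y}" and F = F and I = I and s = ?t] xy c l by auto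
  qed
qed

text \<open>Transport of a lattice along an injection.\<close>

lemma lattice_transport:
  fixes A :: "('b, 'm) gorder_scheme" and g :: "'b \<Rightarrow> 'a"
  assumes A: "lattice A" and g: "inj_on g (carrier A)"
  defines "A' \<equiv> (\<lparr>carrier = g ` carrier A, eq = (=),
     le = (\<lambda>x y. inv_into (carrier A) g x \<sqsubseteq>\<^bsub>A\<^esub> inv_into (carrier A) g y)\<rparr> :: 'a gorder)"
  shows "lattice A'"
proof -
  interpret A: lattice A by fact
  have "partial_order A'"
  proof unfold_locales
    fix x y z
    assume "x \<in> carrier A'" "y \<in> carrier A'" "z \<in> carrier A'"
    then obtain p q r where [simp]: "x = g p" "y = g q" "z = g r"
      and pqr: "p \<in> carrier A" "q \<in> carrier A" "r \<in> carrier A"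
      by (auto simp: A'_def)
    assume "x \<sqsubseteq>\<^bsub>A'\<^esub> y" "y \<sqsubseteq>\<^bsub>A'\<^esub> z"
    with pqr g have "p \<sqsubseteq>\<^bsub>A\<^esub> q" "q \<sqsubseteq>\<^bsub>A\<^esub> r" by (simp_all add: A'_def)
    then have "p \<sqsubseteq>\<^bsub>A\<^esub> r" using A.le_trans pqr by blast
    then show "x \<sqsubseteq>\<^bsub>A'\<^esub> z" using pqr g by (simp add: A'_def)
  next
    fix x y
    assume "x \<in> carrier A'" "y \<in> carrier A'"
    then obtain p q where [simp]: "x = g p" "y = g q"
      and pq: "p \<in> carrier A" "q \<in> carrier A"
      by (auto simp: A'_def)
    assume "x \<sqsubseteq>\<^bsub>A'\<^esub> y" "y \<sqsubseteq>\<^bsub>A'\<^esub> x"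
    with pq g have "p \<sqsubseteq>\<^bsub>A\<^esub> q" "q \<sqsubseteq>\<^bsub>A\<^esub> p" by (simp_all add: A'_def)
    then have "p = q" using A.le_antisym pq by blast
    then show "x .=\<^bsub>A'\<^esub> y" by (simp add: A'_def)
  qed (use g in \<open>auto simp: A'_def\<close>)
  moreover have "bij_betw g (carrier A) (carrier A')"
    using g by (simp add: A'_def bij_betw_def)
  moreover have "g x \<sqsubseteq>\<^bsub>A'\<^esub> g y \<longleftrightarrow> x \<sqsubseteq>\<^bsub>A\<^esub> y"
    if "x \<in> carrier A" "y \<in> carrier A" for x y
    using g that by (simp add: A'_def)
  ultimately show ?thesis by (rule order_iso_lattice(1)[OF A])
qed

lemma directly_indecomposable_any_type:
  fixes L :: "'a gorder" and A :: "('b, 'm) gorder_scheme" and B :: "('c, 'n) gorder_scheme"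
  assumes L: "directly_indecomposable L" and A: "lattice A" and B: "lattice B"
    and a: "a \<in> carrier A" "a' \<in> carrier A" "a \<noteq> a'"
    and b: "b \<in> carrier B" "b' \<in> carrier B" "b \<noteq> b'"
  shows "\<not> lattice_isomorphic L (binary_product_lattice A B)"
proof
  assume "lattice_isomorphic L (binary_product_lattice A B)"
  then obtain f where f: "bij_betw f (carrier L) (carrier A \<times> carrier B)"
    and le: "\<And>x y. x \<in> carrier L \<Longrightarrow> y \<in> carrier L \<Longrightarrow>
      fst (f x) \<sqsubseteq>\<^bsub>A\<^esub> fst (f y) \<and> snd (f x) \<sqsubseteq>\<^bsub>B\<^esub> snd (f y) \<longleftrightarrow> x \<sqsubseteq>\<^bsub>L\<^esub> y"
    unfolding lattice_isomorphic_iff_order_iso by (auto simp: binary_product_lattice_def)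
  let ?k = "inv_into (carrier L) f"
  have k: "inj_on ?k (carrier A \<times> carrier B)"
    using bij_betw_inv_into[OF f] by (simp add: bij_betw_def)
  define g where "g = (\<lambda>x. ?k (x, b))"
  define h where "h = (\<lambda>y. ?k (a, y))"
  have g: "inj_on g (carrier A)" and h: "inj_on h (carrier B)"
    using k a(1) b(1) by (auto simp: g_def h_def inj_on_def)
  define A' where "A' = (\<lparr>carrier = g ` carrier A, eq = (=),
     le = (\<lambda>x y. inv_into (carrier A) g x \<sqsubseteq>\<^bsub>A\<^esub> inv_into (carrier A) g y)\<rparr> :: 'a gorder)"
  define B' where "B' = (\<lparr>carrier = h ` carrier B, eq = (=),
     le = (\<lambda>x y. inv_into (carrier B) h x \<sqsubseteq>\<^bsub>B\<^esub> inv_into (carrier B) h y)\<rparr> :: 'a gorder)"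
  have lat: "lattice A'" "lattice B'"
    unfolding A'_def B'_def by (rule lattice_transport A B g h)+
  have po: "partial_order A'" "partial_order B'"
    using lat by (auto simp: lattice_def upper_semilattice_def)
  have "bij_betw (map_prod g h) (carrier A \<times> carrier B) (carrier A' \<times> carrier B')"
    unfolding bij_betw_def
    using map_prod_inj_on[OF g h] by (auto simp: A'_def B'_def)
  from bij_betw_trans[OF f this]
  have bij: "bij_betw (map_prod g h \<circ> f) (carrier L) (carrier (binary_product_lattice A' B'))"
    by (simp add: binary_product_lattice_def)
  have "lattice_isomorphic L (binary_product_lattice A' B')"
    unfolding lattice_isomorphic_iff_order_iso
  proof (intro conjI exI ballI)
    show "lattice L" using L by (simp add: directly_indecomposable_def)
    show "partial_order (binary_product_lattice A' B')" by (rule partial_order_binary_product[OF po])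
    show "bij_betw (map_prod g h \<circ> f) (carrier L) (carrier (binary_product_lattice A' B'))" by (rule bij)
    fix x y assume xy: "x \<in> carrier L" "y \<in> carrier L"
    then have "f x \<in> carrier A \<times> carrier B" "f y \<in> carrier A \<times> carrier B"
      using f by (auto simp: bij_betw_def)
    then show "((map_prod g h \<circ> f) x \<sqsubseteq>\<^bsub>binary_product_lattice A' B'\<^esub> (map_prod g h \<circ> f) y) \<longleftrightarrow> x \<sqsubseteq>\<^bsub>L\<^esub> y"
      using le[OF xy] g h
      by (auto simp: binary_product_lattice_def A'_def B'_def mem_Times_iff)
  qed
  moreover have "g a \<in> carrier A'" "g a' \<in> carrier A'" "g a \<noteq> g a'"
    "h b \<in> carrier B'" "h b' \<in> carrier B'" "h b \<noteq> h b'"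
    using a b g h by (auto simp: A'_def B'_def inj_on_eq_iff)
  ultimately show False using L lat unfolding directly_indecomposable_def by blast
qed

end

(* Call two join-irreducibles linked if some meet-irreducible lies above neither of them, and let a
   component be the join of a class of the equivalence relation generated by linking.  For two
   distinct components, every meet-irreducible lies above at least one of them, and every
   join-irreducible lies below some component.  Together with bi-spatiality this makes
   x |-> (x meet c)_c an isomorphism onto the product of the intervals [0, c].  In a decomposition
   of [0, c] every join-irreducible lies below one of the two complementary elements e, e', and
   every meet-irreducible not above c lies above one of them, so linked join-irreducibles lie on
   the same side; hence e = c or e' = c. *)

theory Submission
  imports Defs
begin

section \<open>Bi-spatial lattices and comparison through irreducibles\<close>

locale bispatial_lattice = complete_lattice +
  assumes bispatial: "finitely_bispatial L"
begin

text \<open>The join-irreducibles whose join is \<open>x\<close> all lie below \<open>x\<close>, so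
  \<open>y\<close> is an upper bound of them and hence above \<open>x\<close>.\<close>

lemma le_by_join_irreducibles:
  assumes "x \<in> carrier L" "y \<in> carrier L"
    and "\<And>p. join_irreducible L p \<Longrightarrow> p \<sqsubseteq> x \<Longrightarrow> p \<sqsubseteq> y"
  shows "x \<sqsubseteq> y"
proof -
  obtain P where P: "\<forall>p\<in>P. join_irreducible L p" "x = \<Squnion>P"
    using bispatial assms(1) unfolding finitely_bispatial_def by blast
  have c: "P \<subseteq> carrier L" using P(1) by (auto simp: join_irreducible_def)
  have "p \<sqsubseteq> x" if "p \<in> P" for p using weak.sup_upper[OF c that] P(2) by simp
  then show ?thesis unfolding P(2)
    by (intro weak.sup_least) (use P assms c in auto)
qed

lemma le_by_meet_irreducibles:
  assumes "x \<in> carrier L" "y \<in> carrier L"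
    and "\<And>u. meet_irreducible L u \<Longrightarrow> y \<sqsubseteq> u \<Longrightarrow> x \<sqsubseteq> u"
  shows "x \<sqsubseteq> y"
proof -
  obtain U where U: "\<forall>u\<in>U. meet_irreducible L u" "y = \<Sqinter>U"
    using bispatial assms(2) unfolding finitely_bispatial_def by blast
  have c: "U \<subseteq> carrier L" using U(1) by (auto simp: meet_irreducible_def)
  have "y \<sqsubseteq> u" if "u \<in> U" for u using weak.inf_lower[OF c that] U(2) by simp
  then show ?thesis unfolding U(2)
    by (intro weak.inf_greatest) (use U assms c in auto)
qed

section \<open>Linking of join-irreducibles and the components\<close>

definition linked :: "'a \<Rightarrow> 'a \<Rightarrow> bool" where
  "linked p q \<longleftrightarrow> join_irreducible L p \<and> join_irreducible L q \<and>
     (\<exists>u. meet_irreducible L u \<and> \<not> p \<sqsubseteq> u \<and> \<not> q \<sqsubseteq> u)"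

text \<open>Linking is symmetric, so its reflexive-transitive closure is already the generated
  equivalence. This closure relates every value of the type to itself, hence the separate demand
  that \<open>q\<close> be join-irreducible.\<close>

definition block :: "'a \<Rightarrow> 'a set" where
  "block p = {q. join_irreducible L q \<and> linked\<^sup>*\<^sup>* p q}"

text \<open>Joins of classes are collected instead of the classes, so that the index of a factor is
  an element of \<open>L\<close> and also the top of that factor.\<close>

definition components :: "'a set" where
  "components = {\<Squnion>(block p) | p. join_irreducible L p}"

lemma block_closed: "block p \<subseteq> carrier L"
  by (auto simp: block_def join_irreducible_def)

lemma components_closed: "c \<in> components \<Longrightarrow> c \<in> carrier L"
  using block_closed by (auto simp: components_def)

lemma block_eq:
  assumes "linked\<^sup>*\<^sup>* p q"
  shows "block p = block q"
proof -
  have "symp linked" by (auto simp: symp_def linked_def)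
  then have "linked\<^sup>*\<^sup>* q p" using assms by (metis sympD symp_rtranclp)
  with assms show ?thesis unfolding block_def by (auto intro: rtranclp_trans)
qed

lemma join_irreducible_below_component:
  assumes "join_irreducible L p"
  obtains c where "c \<in> components" "p \<sqsubseteq> c"
proof
  show "\<Squnion>(block p) \<in> components" using assms by (auto simp: components_def)
  show "p \<sqsubseteq> \<Squnion>(block p)"
    by (rule weak.sup_upper[OF block_closed]) (use assms in \<open>simp add: block_def\<close>)
qed

text \<open>If \<open>u\<close> were above neither \<open>c\<close> nor \<open>d\<close>, each class
  would have a member not below \<open>u\<close>. These members would be linked through
  \<open>u\<close>, the classes would coincide, and \<open>c = d\<close>.\<close>

lemma meet_irreducible_above_components:
  assumes c: "c \<in> components" and d: "d \<in> components" and "c \<noteq> d"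
    and u: "meet_irreducible L u" and "\<not> c \<sqsubseteq> u"
  shows "d \<sqsubseteq> u"
proof -
  have uL: "u \<in> carrier L" using u by (simp add: meet_irreducible_def)
  obtain p where p: "c = \<Squnion>(block p)" using c by (auto simp: components_def)
  obtain q where q: "d = \<Squnion>(block q)" using d by (auto simp: components_def)
  obtain r where r: "r \<in> block p" "\<not> r \<sqsubseteq> u"
    using \<open>\<not> c \<sqsubseteq> u\<close> weak.sup_least[OF block_closed uL] unfolding p by blast
  have "s \<sqsubseteq> u" if s: "s \<in> block q" for s
  proof (rule ccontr)
    assume "\<not> s \<sqsubseteq> u"
    then have "linked r s" using r s u by (auto simp: linked_def block_def)
    then have "block r = block s" by (intro block_eq) blast
    moreover have "block p = block r" "block q = block s"
      using r s block_eq by (simp_all add: block_def)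
    ultimately show False using p q \<open>c \<noteq> d\<close> by simp
  qed
  then show ?thesis unfolding q by (intro weak.sup_least block_closed uL)
qed

section \<open>Determination of elements by their meets with the components\<close>

lemma le_by_components:
  assumes "x \<in> carrier L" "y \<in> carrier L"
    and "\<And>c. c \<in> components \<Longrightarrow> x \<sqinter> c \<sqsubseteq> y"
  shows "x \<sqsubseteq> y"
proof (rule le_by_join_irreducibles[OF assms(1,2)])
  fix p assume p: "join_irreducible L p" "p \<sqsubseteq> x"
  then have pL: "p \<in> carrier L" by (simp add: join_irreducible_def)
  obtain c where c: "c \<in> components" "p \<sqsubseteq> c"
    using join_irreducible_below_component[OF p(1)] .
  note cL = components_closed[OF c(1)]
  have "p \<sqsubseteq> x \<sqinter> c" using meet_le[OF p(2) c(2) assms(1) cL pL] .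
  from le_trans[OF this assms(3)[OF c(1)]] show "p \<sqsubseteq> y"
    using pL assms cL by simp
qed

text \<open>This gives surjectivity: a family is recovered from its join. A meet-irreducible above
  \<open>a c\<close> is either above \<open>c\<close> or above all other components, and then above
  every \<open>a d\<close> and their join.\<close>

lemma meet_component_sup:
  assumes c: "c \<in> components"
    and a: "\<And>d. d \<in> components \<Longrightarrow> a d \<in> carrier L \<and> a d \<sqsubseteq> d"
  shows "\<Squnion>(a ` components) \<sqinter> c = a c"
proof -
  let ?s = "\<Squnion>(a ` components)"
  have cL: "c \<in> carrier L" using c by (rule components_closed)
  have aL: "a ` components \<subseteq> carrier L" using a by blast
  then have sL: "?s \<in> carrier L" by simp
  have "?s \<sqinter> c \<sqsubseteq> a c"
  proof (rule le_by_meet_irreducibles)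
    fix u assume u: "meet_irreducible L u" "a c \<sqsubseteq> u"
    then have uL: "u \<in> carrier L" by (simp add: meet_irreducible_def)
    show "?s \<sqinter> c \<sqsubseteq> u"
    proof (cases "c \<sqsubseteq> u")
      case True
      show ?thesis
        by (rule le_trans[OF meet_right True]) (use sL cL uL in auto)
    next
      case False
      have "a d \<sqsubseteq> u" if d: "d \<in> components" for d
      proof (cases "d = c")
        case False
        then have "d \<sqsubseteq> u"
          using meet_irreducible_above_components[OF c d _ u(1)] \<open>\<not> c \<sqsubseteq> u\<close> by auto
        then show ?thesis using a[OF d] components_closed[OF d] uL le_trans by blast
      qed (use u in simp)
      then have "?s \<sqsubseteq> u" by (intro weak.sup_least aL uL) auto
      with le_trans[OF meet_left this] show ?thesis using sL cL uL by auto
    qed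
  qed (use sL cL a c in auto)
  moreover have "a c \<sqsubseteq> ?s \<sqinter> c"
    by (intro meet_le weak.sup_upper) (use aL sL cL a c in auto)
  ultimately show ?thesis using le_antisym sL cL a c by simp
qed

text \<open>A weak distributive law, used to carry a splitting inside [0, c] over to
  \<open>L\<close>. A meet-irreducible \<open>u\<close> above \<open>g\<close> but not above
  \<open>c\<close> is above every other component; as \<open>x \<sqinter> c\<close> is below
  \<open>u\<close> through \<open>g\<close>, all of \<open>x\<close> is below
  \<open>u\<close>.\<close>

lemma modular_component:
  assumes c: "c \<in> components" and x: "x \<in> carrier L" and g: "g \<in> carrier L" "x \<sqinter> c \<sqsubseteq> g"
  shows "(x \<squnion> g) \<sqinter> c \<sqsubseteq> g"
proof (rule le_by_meet_irreducibles)
  have cL: "c \<in> carrier L" using c by (rule components_closed)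
  then show "(x \<squnion> g) \<sqinter> c \<in> carrier L" using x g by simp
  fix u assume u: "meet_irreducible L u" "g \<sqsubseteq> u"
  then have uL: "u \<in> carrier L" by (simp add: meet_irreducible_def)
  show "(x \<squnion> g) \<sqinter> c \<sqsubseteq> u"
  proof (cases "c \<sqsubseteq> u")
    case True
    show ?thesis
      by (rule le_trans[OF meet_right True]) (use x g cL uL in auto)
  next
    case False
    have "x \<sqsubseteq> u"
    proof (rule le_by_components[OF x uL])
      fix d assume d: "d \<in> components"
      then have dL: "d \<in> carrier L" by (rule components_closed)
      show "x \<sqinter> d \<sqsubseteq> u"
      proof (cases "d = c")
        case True
        then show ?thesis using le_trans[OF g(2) u(2)] x g cL uL by simp
      next
        case ne: False
        then have "d \<sqsubseteq> u"
          using meet_irreducible_above_components[OF c d _ u(1)] False by auto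
        from le_trans[OF meet_right this] show ?thesis using x dL uL by simp
      qed
    qed
    then have "x \<squnion> g \<sqsubseteq> u" using join_le u x g uL by blast
    from le_trans[OF meet_left this] show ?thesis using x g cL uL by simp
  qed
qed (rule g)

section \<open>Direct indecomposability of the interval below a component\<close>

lemma component_connected:
  assumes p: "join_irreducible L p" and c: "c = \<Squnion>(block p)"
    and e: "e \<in> carrier L" "e' \<in> carrier L" and "p \<sqsubseteq> e"
    and J: "\<And>q. join_irreducible L q \<Longrightarrow> q \<sqsubseteq> c \<Longrightarrow> q \<sqsubseteq> e \<or> q \<sqsubseteq> e'"
    and M: "\<And>u. meet_irreducible L u \<Longrightarrow> \<not> c \<sqsubseteq> u \<Longrightarrow> e \<sqsubseteq> u \<or> e' \<sqsubseteq> u"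
  shows "c \<sqsubseteq> e"
  unfolding c
proof (intro weak.sup_least block_closed e(1))
  fix q assume "q \<in> block p"
  then have "linked\<^sup>*\<^sup>* p q" by (simp add: block_def)
  then show "q \<sqsubseteq> e"
  proof (induction rule: rtranclp_induct)
    case base
    show ?case by fact
  next
    case (step q r)
    obtain u where u: "meet_irreducible L u" "\<not> q \<sqsubseteq> u" "\<not> r \<sqsubseteq> u"
      and qr: "join_irreducible L q" "join_irreducible L r"
      using step.hyps(2) by (auto simp: linked_def)
    have L: "u \<in> carrier L" "q \<in> carrier L" "r \<in> carrier L"
      using u qr by (auto simp: meet_irreducible_def join_irreducible_def)
    have mem: "q \<in> block p" "r \<in> block p" using step.hyps qr by (auto simp: block_def)
    have le: "q \<sqsubseteq> c" "r \<sqsubseteq> c" using weak.sup_upper[OF block_closed] mem c by auto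
    have cL: "c \<in> carrier L" using block_closed c by simp
    \<comment> \<open>Since \<open>q\<close> is below \<open>e\<close> but not below the linking
      \<open>u\<close>, \<open>e\<close> is not below \<open>u\<close>. So \<open>M\<close> puts
      \<open>e'\<close> below \<open>u\<close>; then \<open>r\<close> cannot be below
      \<open>e'\<close>, and \<open>J\<close> puts it below \<open>e\<close>.\<close>
    have "\<not> e \<sqsubseteq> u" using step.IH u(2) L e le_trans by blast
    moreover have "\<not> c \<sqsubseteq> u" using le(1) u(2) L cL le_trans by blast
    ultimately have "e' \<sqsubseteq> u" using M u(1) by blast
    then have "\<not> r \<sqsubseteq> e'" using u(3) L e le_trans by blast
    then show ?case using J qr le by blast
  qed
qed

lemma lattice_interval:
  assumes "c \<in> carrier L"
  shows "lattice (L\<lparr>carrier := \<lbrace>\<bottom>..c\<rbrace>\<rparr>)"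
proof -
  interpret I: weak_complete_lattice "L\<lparr>carrier := \<lbrace>\<bottom>..c\<rbrace>\<rparr>"
    by (rule weak_complete_lattice_interval)
      (use assms weak.weak_complete_lattice_axioms in auto)
  show ?thesis
    by unfold_locales (auto simp: eq_is_equal intro: I.sup_of_two_exists I.inf_of_two_exists)
qed

lemma mem_interval: "x \<in> \<lbrace>\<bottom>..c\<rbrace> \<longleftrightarrow> x \<in> carrier L \<and> x \<sqsubseteq> c"
  by (auto simp: at_least_at_most_def)

text \<open>The elements with coordinates (top, bottom) and (bottom, top) satisfy the two conditions
  of \<open>component_connected\<close>. Hence one of them is above \<open>c\<close>, and the bounds
  of one factor coincide.\<close>

lemma component_factor_trivial:
  assumes c: "c \<in> components"
    and A: "partial_order A" and B: "partial_order B"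
    and f: "bij_betw f \<lbrace>\<bottom>..c\<rbrace> (carrier A \<times> carrier B)"
    and le: "\<And>x y. x \<in> \<lbrace>\<bottom>..c\<rbrace> \<Longrightarrow> y \<in> \<lbrace>\<bottom>..c\<rbrace> \<Longrightarrow>
      fst (f x) \<sqsubseteq>\<^bsub>A\<^esub> fst (f y) \<and> snd (f x) \<sqsubseteq>\<^bsub>B\<^esub> snd (f y) \<longleftrightarrow> x \<sqsubseteq> y"
  shows "(\<forall>a\<in>carrier A. \<forall>a'\<in>carrier A. a = a') \<or> (\<forall>b\<in>carrier B. \<forall>b'\<in>carrier B. b = b')"
proof -
  interpret A: partial_order A by fact
  interpret B: partial_order B by fact
  have cL: "c \<in> carrier L" using c by (rule components_closed)
  \<comment> \<open>The inverse of \<open>f\<close>, curried: \<open>g a b\<close> is the element of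
    [0, c] with coordinates \<open>a\<close> and \<open>b\<close>.\<close>
  define g where "g = (\<lambda>a b. inv_into \<lbrace>\<bottom>..c\<rbrace> f (a, b))"
  have g: "g a b \<in> carrier L" "g a b \<sqsubseteq> c" "f (g a b) = (a, b)"
    if "a \<in> carrier A" "b \<in> carrier B" for a b
    using that bij_betw_inv_into_right[OF f, of "(a, b)"]
      bij_betw_apply[OF bij_betw_inv_into[OF f], of "(a, b)"]
    by (auto simp: g_def mem_interval)
  have g_le: "g a b \<sqsubseteq> x \<longleftrightarrow> a \<sqsubseteq>\<^bsub>A\<^esub> fst (f x) \<and> b \<sqsubseteq>\<^bsub>B\<^esub> snd (f x)"
    and le_g: "x \<sqsubseteq> g a b \<longleftrightarrow> fst (f x) \<sqsubseteq>\<^bsub>A\<^esub> a \<and> snd (f x) \<sqsubseteq>\<^bsub>B\<^esub> b"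
    if "a \<in> carrier A" "b \<in> carrier B" "x \<in> carrier L" "x \<sqsubseteq> c" for a b x
    using that g[OF that(1,2)] le[of "g a b" x] le[of x "g a b"] by (auto simp: mem_interval)
  have f_mem: "fst (f x) \<in> carrier A" "snd (f x) \<in> carrier B"
    if "x \<in> carrier L" "x \<sqsubseteq> c" for x
    using bij_betw_apply[OF f, of x] that by (auto simp: mem_interval mem_Times_iff)
  \<comment> \<open>The coordinates of \<bottom> and of \<open>c\<close> are the bounds of the two
    factors.\<close>
  define a\<^sub>0 b\<^sub>0 a\<^sub>1 b\<^sub>1
    where "a\<^sub>0 = fst (f \<bottom>)" and "b\<^sub>0 = snd (f \<bottom>)" and "a\<^sub>1 = fst (f c)" and "b\<^sub>1 = snd (f c)"
  note bounds_def = a\<^sub>0_def b\<^sub>0_def a\<^sub>1_def b\<^sub>1_def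
  have m: "a\<^sub>0 \<in> carrier A" "a\<^sub>1 \<in> carrier A" "b\<^sub>0 \<in> carrier B" "b\<^sub>1 \<in> carrier B"
    using f_mem cL by (auto simp: bounds_def)
  have bd: "a\<^sub>0 \<sqsubseteq>\<^bsub>A\<^esub> a" "a \<sqsubseteq>\<^bsub>A\<^esub> a\<^sub>1" "b\<^sub>0 \<sqsubseteq>\<^bsub>B\<^esub> b" "b \<sqsubseteq>\<^bsub>B\<^esub> b\<^sub>1"
    if "a \<in> carrier A" "b \<in> carrier B" for a b
    using le_g[OF that, of \<bottom>] g_le[OF that, of c] g[OF that] cL by (auto simp: bounds_def)
  let ?e = "g a\<^sub>1 b\<^sub>0" and ?e' = "g a\<^sub>0 b\<^sub>1"
  \<comment> \<open>In coordinates, \<open>(x, y)\<close> is the join of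
    \<open>(x, b\<^sub>0)\<close> and \<open>(a\<^sub>0, y)\<close>. Irreducibility makes
    \<open>q\<close> one of these, and they lie below \<open>?e\<close> and \<open>?e'\<close>
    respectively.\<close>
  have J: "q \<sqsubseteq> ?e \<or> q \<sqsubseteq> ?e'" if q: "join_irreducible L q" "q \<sqsubseteq> c" for q
  proof -
    have qL: "q \<in> carrier L" using q by (simp add: join_irreducible_def)
    let ?x = "fst (f q)" and ?y = "snd (f q)"
    note xy = f_mem[OF qL q(2)]
    let ?s = "g ?x b\<^sub>0 \<squnion> g a\<^sub>0 ?y"
    have sL: "?s \<in> carrier L" using g m xy by simp
    have le_q: "g ?x b\<^sub>0 \<sqsubseteq> q" "g a\<^sub>0 ?y \<sqsubseteq> q" using g_le m xy bd qL q(2) by auto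
    then have sq: "?s \<sqsubseteq> q" using join_le g m xy qL by auto
    \<comment> \<open>The join is formed in \<open>L\<close>; being below \<open>q\<close> it stays
      in [0, c], where coordinates decide the order.\<close>
    have sc: "?s \<sqsubseteq> c" using le_trans[OF sq q(2)] sL qL cL by simp
    have "g ?x b\<^sub>0 \<sqsubseteq> ?s" "g a\<^sub>0 ?y \<sqsubseteq> ?s" using join_left join_right g m xy by auto
    then have "?x \<sqsubseteq>\<^bsub>A\<^esub> fst (f ?s)" "?y \<sqsubseteq>\<^bsub>B\<^esub> snd (f ?s)"
      using g_le m xy sL sc by auto
    then have "q \<sqsubseteq> ?s" using le[of q ?s] sL sc qL q(2) by (simp add: mem_interval)
    then have "q = ?s" using sq le_antisym qL sL by blast
    moreover have "g ?x b\<^sub>0 \<in> carrier L" "g a\<^sub>0 ?y \<in> carrier L" using g m xy by auto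
    ultimately have "q = g ?x b\<^sub>0 \<or> q = g a\<^sub>0 ?y"
      using q(1) unfolding join_irreducible_def by blast
    moreover have "g ?x b\<^sub>0 \<sqsubseteq> ?e" "g a\<^sub>0 ?y \<sqsubseteq> ?e'" using g_le g m xy bd by auto
    ultimately show ?thesis by metis
  qed
  \<comment> \<open>Since \<open>u\<close> may lie outside [0, c], coordinates are taken of
    \<open>u \<sqinter> c\<close>. Inside [0, c] this is the meet of the elements
    \<open>(a\<^sub>1, y)\<close> and \<open>(x, b\<^sub>1)\<close>.\<close>
  have M: "?e \<sqsubseteq> u \<or> ?e' \<sqsubseteq> u" if u: "meet_irreducible L u" "\<not> c \<sqsubseteq> u" for u
  proof -
    have uL: "u \<in> carrier L" using u by (simp add: meet_irreducible_def)
    have w: "u \<sqinter> c \<in> carrier L" "u \<sqinter> c \<sqsubseteq> c" using uL cL meet_right by auto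
    let ?x = "fst (f (u \<sqinter> c))" and ?y = "snd (f (u \<sqinter> c))"
    note xy = f_mem[OF w]
    let ?g = "g a\<^sub>1 ?y" and ?g' = "g ?x b\<^sub>1"
    have gL: "?g \<in> carrier L" "?g' \<in> carrier L" using g m xy by auto
    \<comment> \<open>Joining with \<open>u\<close> lifts that meet from [0, c] to \<open>L\<close>.
      Once \<open>?t\<close> is shown to equal \<open>u\<close>, meet-irreducibility puts
      \<open>?g\<close> or \<open>?g'\<close> below \<open>u\<close>.\<close>
    let ?t = "(u \<squnion> ?g) \<sqinter> (u \<squnion> ?g')"
    have tL: "?t \<in> carrier L" using gL uL by simp
    have wg: "u \<sqinter> c \<sqsubseteq> ?g" "u \<sqinter> c \<sqsubseteq> ?g'" using le_g m xy bd w by auto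
    have "?t \<sqsubseteq> u"
    proof (rule le_by_components[OF tL uL])
      fix d assume d: "d \<in> components"
      then have dL: "d \<in> carrier L" by (rule components_closed)
      show "?t \<sqinter> d \<sqsubseteq> u"
      proof (cases "d = c")
        case True
        let ?z = "?t \<sqinter> c"
        have zL: "?z \<in> carrier L" "?z \<sqsubseteq> c" using tL cL meet_right by auto
        have zt: "?z \<sqsubseteq> ?t" using meet_left tL cL by simp
        have "?z \<sqsubseteq> u \<squnion> ?g" "?z \<sqsubseteq> u \<squnion> ?g'"
          using le_trans[OF zt meet_left] le_trans[OF zt meet_right] zL tL gL uL by auto
        \<comment> \<open>By \<open>modular_component\<close>, \<open>?z\<close> lies below both
          \<open>?g\<close> and \<open>?g'\<close>; the former bounds its second coordinate, the
          latter its first.\<close>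
        then have "?z \<sqsubseteq> (u \<squnion> ?g) \<sqinter> c" "?z \<sqsubseteq> (u \<squnion> ?g') \<sqinter> c"
          using meet_le zL gL uL cL by auto
        then have "?z \<sqsubseteq> ?g" "?z \<sqsubseteq> ?g'"
          using modular_component[OF c uL gL(1) wg(1)] modular_component[OF c uL gL(2) wg(2)]
            le_trans zL gL uL cL by (meson join_closed meet_closed)+
        then have "fst (f ?z) \<sqsubseteq>\<^bsub>A\<^esub> ?x" "snd (f ?z) \<sqsubseteq>\<^bsub>B\<^esub> ?y"
          using le_g m xy zL by auto
        then have "?z \<sqsubseteq> u \<sqinter> c" using le[of ?z "u \<sqinter> c"] zL w by (simp add: mem_interval)
        then have "?z \<sqsubseteq> u" using le_trans[OF _ meet_left] zL w uL cL by blast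
        then show ?thesis using True by simp
      next
        case False
        then have "d \<sqsubseteq> u" using meet_irreducible_above_components[OF c d _ u] by auto
        from le_trans[OF meet_right this] show ?thesis using tL dL uL by simp
      qed
    qed
    moreover have "u \<sqsubseteq> ?t" using meet_le join_left gL uL by simp
    ultimately have "u = ?t" using le_antisym tL uL by blast
    then have "u = u \<squnion> ?g \<or> u = u \<squnion> ?g'"
      using u(1) gL uL unfolding meet_irreducible_def by (metis join_closed)
    then have "?g \<sqsubseteq> u \<or> ?g' \<sqsubseteq> u" using join_right gL uL by metis
    moreover have "?e \<sqsubseteq> ?g" "?e' \<sqsubseteq> ?g'" using g_le g m xy bd by auto
    moreover have "?e \<in> carrier L" "?e' \<in> carrier L" using g m by auto
    ultimately show ?thesis using le_trans[of ?e ?g u] le_trans[of ?e' ?g' u] gL uL by blast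
  qed
  obtain p where p: "join_irreducible L p" "c = \<Squnion>(block p)"
    using c by (auto simp: components_def)
  have pc: "p \<sqsubseteq> c" unfolding p(2)
    by (rule weak.sup_upper[OF block_closed]) (use p(1) in \<open>simp add: block_def\<close>)
  have eL: "?e \<in> carrier L" "?e' \<in> carrier L" using g m by auto
  from J[OF p(1) pc] show ?thesis
  proof
    assume "p \<sqsubseteq> ?e"
    from component_connected[OF p eL this J M] have "c \<sqsubseteq> ?e" .
    \<comment> \<open>Here \<open>c\<close> has coordinates \<open>(a\<^sub>1, b\<^sub>1)\<close>
      and \<open>?e\<close> has \<open>(a\<^sub>1, b\<^sub>0)\<close>.\<close>
    then have "b\<^sub>1 \<sqsubseteq>\<^bsub>B\<^esub> b\<^sub>0" using le_g m cL by (simp add: bounds_def)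
    then have "b = b\<^sub>0" if "b \<in> carrier B" for b
      using that bd(3,4)[OF m(1) that] m B.le_antisym[of b b\<^sub>0] B.le_trans[of b b\<^sub>1 b\<^sub>0] by blast
    then show ?thesis by blast
  next
    assume "p \<sqsubseteq> ?e'"
    \<comment> \<open>The roles of \<open>?e\<close> and \<open>?e'\<close> are exchanged, so both
      disjunctions are commuted.\<close>
    from component_connected[OF p eL(2,1) this J[THEN disj_commute[THEN iffD1]]
        M[THEN disj_commute[THEN iffD1]]]
    have "c \<sqsubseteq> ?e'" .
    then have "a\<^sub>1 \<sqsubseteq>\<^bsub>A\<^esub> a\<^sub>0" using le_g m cL by (simp add: bounds_def)
    then have "a = a\<^sub>0" if "a \<in> carrier A" for a
      using that bd(1,2)[OF that m(3)] m A.le_antisym[of a a\<^sub>0] A.le_trans[of a a\<^sub>1 a\<^sub>0] by blast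
    then show ?thesis by blast
  qed
qed

section \<open>The isomorphism onto the product of the intervals\<close>

lemma lattice_isomorphic_components:
  "lattice_isomorphic L (product_lattice components (\<lambda>c. L\<lparr>carrier := \<lbrace>\<bottom>..c\<rbrace>\<rparr>))"
    (is "lattice_isomorphic L (product_lattice _ ?F)")
  unfolding lattice_isomorphic_iff_order_iso
proof (intro conjI exI ballI)
  show "lattice L" by (rule lattice_axioms)
  have "lattice (product_lattice components ?F)"
    by (intro lattice_product lattice_interval components_closed)
  then show "partial_order (product_lattice components ?F)"
    by (simp add: lattice_def upper_semilattice_def)
  \<comment> \<open>The restriction makes the images extensional, as the carrier of
    \<open>product_lattice\<close> requires.\<close>
  let ?f = "\<lambda>x. \<lambda>c\<in>components. x \<sqinter> c"
  show iff: "?f x \<sqsubseteq>\<^bsub>product_lattice components ?F\<^esub> ?f y \<longleftrightarrow> x \<sqsubseteq> y"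
    if "x \<in> carrier L" "y \<in> carrier L" for x y
  proof -
    have "x \<sqinter> c \<sqsubseteq> y \<sqinter> c \<longleftrightarrow> x \<sqinter> c \<sqsubseteq> y" if "c \<in> components" for c
      using meet_le[of "x \<sqinter> c" y c] meet_right[of x c] le_trans[OF _ meet_left, of "x \<sqinter> c" y c]
        components_closed[OF that] \<open>x \<in> _\<close> \<open>y \<in> _\<close> by auto
    moreover have "x \<sqinter> c \<sqsubseteq> y" if "c \<in> components" "x \<sqsubseteq> y" for c
      using le_trans[OF meet_left that(2)] components_closed[OF that(1)] \<open>x \<in> _\<close> \<open>y \<in> _\<close> by simp
    ultimately show ?thesis
      using le_by_components[OF that] by (auto simp: product_lattice_def)
  qed
  show "bij_betw ?f (carrier L) (carrier (product_lattice components ?F))"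
  proof (rule bij_betw_imageI)
    show "inj_on ?f (carrier L)"
    proof (rule inj_onI)
      fix x y assume xy: "x \<in> carrier L" "y \<in> carrier L" "?f x = ?f y"
      \<comment> \<open>Equal images compare both ways by reflexivity, and \<open>iff\<close>
        reflects this to \<open>x\<close> and \<open>y\<close>.\<close>
      then have "x \<sqsubseteq> y" "y \<sqsubseteq> x"
        using iff[OF xy(1,2)] iff[OF xy(2,1)] iff[OF xy(1,1)] iff[OF xy(2,2)] by auto
      then show "x = y" using le_antisym xy by blast
    qed
    show "?f ` carrier L = carrier (product_lattice components ?F)"
    proof (intro equalityI subsetI)
      fix a assume "a \<in> ?f ` carrier L"
      then show "a \<in> carrier (product_lattice components ?F)"
        using components_closed meet_right by (auto simp: product_lattice_def mem_interval)
    next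
      fix a assume a: "a \<in> carrier (product_lattice components ?F)"
      then have ac: "a d \<in> carrier L \<and> a d \<sqsubseteq> d" if "d \<in> components" for d
        using that by (auto simp: product_lattice_def mem_interval dest: PiE_mem)
      \<comment> \<open>The equation holds at every \<open>c\<close> of the type, since outside
        \<open>components\<close> both sides are \<open>undefined\<close>; this permits function
        extensionality.\<close>
      have "?f (\<Squnion>(a ` components)) c = a c" for c
        using meet_component_sup[OF _ ac] a PiE_arb[of a components "\<lambda>c. \<lbrace>\<bottom>..c\<rbrace>" c]
        by (auto simp: product_lattice_def)
      then have "a = ?f (\<Squnion>(a ` components))" by (intro ext) simp
      moreover have "\<Squnion>(a ` components) \<in> carrier L" using ac by (intro weak.sup_closed) blast
      ultimately show "a \<in> ?f ` carrier L" by blast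
    qed
  qed
qed

end

theorem theorem3p7:
  fixes L :: "'a gorder"
  assumes "complete_lattice L" and "finitely_bispatial L"
  shows "\<exists>(I :: 'a set) (F :: 'a \<Rightarrow> 'a gorder).
           (\<forall>i\<in>I. directly_indecomposable (F i)) \<and> lattice_isomorphic L (product_lattice I F)"
proof -
  interpret bispatial_lattice L
    using assms by (simp add: bispatial_lattice_def bispatial_lattice_axioms_def)
  let ?F = "\<lambda>c. L\<lparr>carrier := \<lbrace>\<bottom>\<^bsub>L\<^esub>..c\<rbrace>\<^bsub>L\<^esub>\<rparr>"
  have "directly_indecomposable (?F c)" if c: "c \<in> components" for c
    unfolding directly_indecomposable_def
  proof (intro conjI notI)
    show "lattice (?F c)" using lattice_interval components_closed c by blast
    assume "\<exists>(A :: 'a gorder) (B :: 'a gorder). lattice A \<and> lattice B \<and>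
          (\<exists>a\<in>carrier A. \<exists>a'\<in>carrier A. a \<noteq> a') \<and>
          (\<exists>b\<in>carrier B. \<exists>b'\<in>carrier B. b \<noteq> b') \<and>
          lattice_isomorphic (?F c) (binary_product_lattice A B)"
    then obtain A B :: "'a gorder" where AB: "lattice A" "lattice B"
      and ne: "\<exists>a\<in>carrier A. \<exists>a'\<in>carrier A. a \<noteq> a'" "\<exists>b\<in>carrier B. \<exists>b'\<in>carrier B. b \<noteq> b'"
      and iso: "lattice_isomorphic (?F c) (binary_product_lattice A B)" by blast
    have po: "partial_order A" "partial_order B"
      using AB by (auto simp: lattice_def upper_semilattice_def)
    obtain f where f: "bij_betw f \<lbrace>\<bottom>\<^bsub>L\<^esub>..c\<rbrace>\<^bsub>L\<^esub> (carrier A \<times> carrier B)"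
      and le: "\<And>x y. x \<in> \<lbrace>\<bottom>\<^bsub>L\<^esub>..c\<rbrace>\<^bsub>L\<^esub> \<Longrightarrow> y \<in> \<lbrace>\<bottom>\<^bsub>L\<^esub>..c\<rbrace>\<^bsub>L\<^esub> \<Longrightarrow>
        fst (f x) \<sqsubseteq>\<^bsub>A\<^esub> fst (f y) \<and> snd (f x) \<sqsubseteq>\<^bsub>B\<^esub> snd (f y) \<longleftrightarrow> x \<sqsubseteq>\<^bsub>L\<^esub> y"
      using iso unfolding lattice_isomorphic_iff_order_iso
      by (auto simp: binary_product_lattice_def)
    from component_factor_trivial[OF c po f le] ne show False by blast
  qed
  \<comment> \<open>If \<open>L\<close> has a single element, there are no components and the
    product is the one-element empty product.\<close>
  with lattice_isomorphic_components show ?thesis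
    by (intro exI[of _ components] exI[of _ ?F]) simp
qed

end
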